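(* Let $r\ge 1$ be a fixed integer and $p_1,\dots,p_r$ fixed distinct primes. Let $P^{(e)}(p_1,\dots,p_r;x)$ denote the number of ordered pairs $\langle n,m\rangle$ of exponentially coprime positive integers with $\kappa(n)=\kappa(m)=p_1\cdots p_r$ and $n,m\le x$. Then $$ P^{(e)}(p_1,\dots,p_r;x)= \frac1{(r!)^2(\zeta(2))^r} \left( \prod_{i=1}^r \frac1{(\log p_i)^2}\right)(\log x)^{2r} + O\left( (\log x)^{2r-1} \log \log x \right) $$ as $x\to\infty$.
   Context: For $n>1$ with canonical factorization $n=\prod_{i=1}^r p_i^{a_i}$, $\kappa(n)=\prod_{i=1}^r p_i$ is its squarefree kernel. Two integers $n,m>1$ are called exponentially coprime if they have the same prime factors, say $n=\prod_{i=1}^r p_i^{a_i}$ and $m=\prod_{i=1}^r p_i^{b_i}$ with $a_i,b_i\ge 1$, and $\gcd(a_i,b_i)=1$ for every $1\le i\le r$. $\zeta$ is the Riemann zeta function. *)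

theory Defs
  imports Complex_Main "HOL-Computational_Algebra.Computational_Algebra"
    "HOL-Library.Landau_Symbols"
begin

definition squarefree_kernel :: "nat \<Rightarrow> nat" where
  "squarefree_kernel n = \<Prod>(prime_factors n)"

definition exponentially_coprime :: "nat \<Rightarrow> nat \<Rightarrow> bool" where
  "exponentially_coprime n m \<longleftrightarrow>
     n > 1 \<and> m > 1 \<and> prime_factors n = prime_factors m \<and>
     (\<forall>q \<in> prime_factors n. coprime (multiplicity q n) (multiplicity q m))"

text \<open>
  The Riemann zeta function on the real half-line \<open>s > 1\<close>, where its Dirichlet series
  converges; outside this range the value below is meaningless.
\<close>

definition riemann_zeta :: "real \<Rightarrow> real" where
  "riemann_zeta s = (\<Sum>n. 1 / real (Suc n) powr s)"

text \<open>
  The \<open>r\<close> primes are given as the values of \<open>p\<close> on \<open>{1..r}\<close>; other values of \<open>p\<close> are irrelevant.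
\<close>

definition exp_coprime_pairs :: "nat \<Rightarrow> (nat \<Rightarrow> nat) \<Rightarrow> real \<Rightarrow> (nat \<times> nat) set" where
  "exp_coprime_pairs r p x =
     {(n, m). exponentially_coprime n m \<and>
              squarefree_kernel n = (\<Prod>i\<in>{1..r}. p i) \<and>
              squarefree_kernel m = (\<Prod>i\<in>{1..r}. p i) \<and>
              real n \<le> x \<and> real m \<le> x}"

definition P_exp :: "nat \<Rightarrow> (nat \<Rightarrow> nat) \<Rightarrow> real \<Rightarrow> nat" where
  "P_exp r p x = card (exp_coprime_pairs r p x)"

end

(* Writing n and m as products of the p_i ^ a_i and p_i ^ b_i turns the count into one of lattice
   points (a, b) with coprime coordinate pairs under two linear constraints. The proof is by
   induction on the set S of primes, for independent bounds X, Y <= T on ln n and ln m, with error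
   O(T ^ (2 |S| - 1) ln T). Adding a prime q sums the previous main term over coprime exponents
   (a, b) of q: Moebius inversion separates a from b, each inner sum is
   sum_(a >= 1) (X - a d c) ^ k = X ^ (k + 1) / ((k + 1) d c) + O(X ^ k) with c = ln q, and
   sum_(d <= D) mu(d) / d ^ 2 = 1 / zeta(2) + O(ln D / D). The logarithm in the error comes from
   the harmonic sum over d <= T / c of the cross terms of order T ^ (2 k + 1) / d. *)

theory Submission
  imports Defs
begin

section \<open>Moebius inversion over coprime pairs\<close>

definition moebius :: "nat \<Rightarrow> real" where
  "moebius n = (if squarefree n then (- 1) ^ card (prime_factors n) else 0)"

lemma abs_moebius_le_1: "\<bar>moebius n\<bar> \<le> 1"
  by (simp add: moebius_def power_abs)

text \<open>For a prime \<open>q\<close> dividing \<open>n\<close>, the map from \<open>d\<close> to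
  \<open>q * d\<close> pairs the squarefree divisors not divisible by \<open>q\<close> with those
  divisible by \<open>q\<close> and flips the sign of \<open>moebius\<close>, so their sum cancels.
  The other divisors contribute 0.\<close>

lemma sum_moebius_divisors:
  assumes "n > 0"
  shows "(\<Sum>d | d dvd n. moebius d) = (if n = 1 then 1 else 0)"
proof (cases "n = 1")
  case True
  then show ?thesis by (simp add: moebius_def)
next
  case False
  then obtain q where q: "prime q" "q dvd n"
    using prime_factor_nat by blast
  let ?A = "{d. d dvd n \<and> squarefree d \<and> \<not> q dvd d}"
  let ?B = "{d. d dvd n \<and> squarefree d \<and> q dvd d}"
  have fin: "finite {d. d dvd n}" using assms by simp
  have "(\<Sum>d | d dvd n. moebius d) = (\<Sum>d\<in>?A \<union> ?B. moebius d)"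
    by (rule sum.mono_neutral_right) (use fin in \<open>auto simp: moebius_def\<close>)
  also have "\<dots> = sum moebius ?A + sum moebius ?B"
    by (rule sum.union_disjoint) (use fin in \<open>auto elim: rev_finite_subset\<close>)
  also have "sum moebius ?B = (\<Sum>d\<in>?A. - moebius d)"
  proof (rule sum.reindex_bij_witness[of _ "\<lambda>d. q * d" "\<lambda>d. d div q"])
    fix d assume d: "d \<in> ?B"
    then obtain e where e: "d = q * e" by auto
    have sf: "squarefree e" using d e squarefree_mono[of e d] by auto
    have ndvd: "\<not> q dvd e"
    proof
      assume "q dvd e"
      then have "q\<^sup>2 dvd d" using e by (auto simp: power2_eq_square)
      then show False using d q unfolding squarefree_def by auto
    qed
    have "q \<noteq> 0" using q by auto
    show "d div q \<in> ?A" using d e sf ndvd \<open>q \<noteq> 0\<close> by (auto dest: dvd_mult_right)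
    show "q * (d div q) = d" using e by auto
    have "e \<noteq> 0" using ndvd by (metis dvd_0_right)
    have "prime_factors d = insert q (prime_factors e)"
      using q \<open>e \<noteq> 0\<close> \<open>q \<noteq> 0\<close> e by (simp add: prime_factors_product prime_prime_factors)
    moreover have "q \<notin> prime_factors e" using ndvd by auto
    ultimately show "- moebius (d div q) = moebius d"
      using d e sf \<open>q \<noteq> 0\<close> by (simp add: moebius_def)
  next
    fix d assume d: "d \<in> ?A"
    have "q \<noteq> 0" using q by auto
    then show "q * d div q = d" by simp
    have cop: "coprime q d" using d q by (simp add: prime_imp_coprime)
    moreover have "squarefree q" using q by (simp add: squarefree_prime)
    ultimately show "q * d \<in> ?B"
      using d q by (auto intro: divides_mult squarefree_mult_coprime)
  qed
  finally show ?thesis using False by (simp add: sum_negf)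
qed

text \<open>The range \<open>{1..D}\<close> contains every divisor of \<open>n\<close> and does not
  depend on \<open>n\<close>, so a sum over \<open>n\<close> can be exchanged with the sum over
  \<open>d\<close>.\<close>

lemma sum_moebius_atLeastAtMost:
  assumes "0 < n" "n \<le> D"
  shows "(\<Sum>d\<in>{1..D}. if d dvd n then moebius d else 0) = (if n = 1 then 1 else 0)"
proof -
  have "(\<Sum>d\<in>{1..D}. if d dvd n then moebius d else 0) = (\<Sum>d | d dvd n. moebius d)"
    by (rule sum.mono_neutral_cong_right)
      (use assms in \<open>auto simp: Suc_le_eq dvd_pos_nat dest: dvd_imp_le intro: order_trans[OF dvd_imp_le]\<close>)
  then show ?thesis using sum_moebius_divisors assms by simp
qed

lemma sum_multiples:
  fixes f :: "nat \<Rightarrow> 'a :: comm_monoid_add"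
  assumes "d > 0"
  shows "(\<Sum>a\<in>{1..A}. if d dvd a then f a else 0) = (\<Sum>a\<in>{1..A div d}. f (d * a))"
proof -
  have "(\<Sum>a\<in>{1..A}. if d dvd a then f a else 0) = (\<Sum>a\<in>{a\<in>{1..A}. d dvd a}. f a)"
    by (rule sum.inter_filter[symmetric]) simp
  also have "\<dots> = (\<Sum>a\<in>{1..A div d}. f (d * a))"
    by (rule sum.reindex_bij_witness[of _ "\<lambda>a. d * a" "\<lambda>a. a div d"])
      (use assms in \<open>auto simp: div_le_mono less_eq_div_iff_mult_less_eq mult.commute Suc_le_eq\<close>)
  finally show ?thesis .
qed

text \<open>The indicator of coprimality is the sum of \<open>moebius d\<close> over all
  \<open>d\<close> dividing both \<open>a\<close> and \<open>b\<close>. The two divisibility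
  conditions separate, so for each \<open>d\<close> the double sum factors. Since
  \<open>gcd a b \<le> a\<close>, the bound \<open>A \<le> D\<close> captures every \<open>d\<close>
  that occurs.\<close>

lemma sum_coprime_moebius:
  fixes f g :: "nat \<Rightarrow> real"
  assumes "A \<le> D"
  shows "(\<Sum>a\<in>{1..A}. \<Sum>b\<in>{1..B}. if coprime a b then f a * g b else 0) =
    (\<Sum>d\<in>{1..D}. moebius d * ((\<Sum>a\<in>{1..A div d}. f (d * a)) * (\<Sum>b\<in>{1..B div d}. g (d * b))))"
proof -
  have "(\<Sum>a\<in>{1..A}. \<Sum>b\<in>{1..B}. if coprime a b then f a * g b else 0) =
    (\<Sum>a\<in>{1..A}. \<Sum>b\<in>{1..B}. \<Sum>d\<in>{1..D}.
      moebius d * ((if d dvd a then f a else 0) * (if d dvd b then g b else 0)))"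
  proof (intro sum.cong refl)
    fix a b assume ab: "a \<in> {1..A}" "b \<in> {1..B}"
    have "gcd a b \<le> a" using ab by (intro gcd_le1_nat) auto
    then have "gcd a b \<le> D" using ab assms by (meson atLeastAtMost_iff order_trans)
    moreover have "gcd a b > 0" using ab by auto
    ultimately have "(if coprime a b then 1 else 0) =
        (\<Sum>d\<in>{1..D}. if d dvd gcd a b then moebius d else 0)"
      using sum_moebius_atLeastAtMost[of "gcd a b" D] by (simp add: coprime_iff_gcd_eq_1)
    then have "(if coprime a b then f a * g b else 0) =
        (\<Sum>d\<in>{1..D}. if d dvd gcd a b then moebius d else 0) * (f a * g b)"
      by (metis mult_1 mult_zero_left)
    also have "\<dots> = (\<Sum>d\<in>{1..D}.
      moebius d * ((if d dvd a then f a else 0) * (if d dvd b then g b else 0)))"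
      unfolding sum_distrib_right by (intro sum.cong) auto
    finally show "(if coprime a b then f a * g b else 0) = \<dots>" .
  qed
  also have "\<dots> = (\<Sum>d\<in>{1..D}. \<Sum>a\<in>{1..A}. \<Sum>b\<in>{1..B}.
      moebius d * ((if d dvd a then f a else 0) * (if d dvd b then g b else 0)))"
    by (simp only: sum.swap[of _ "{1..D}" "{1..B}"] sum.swap[of _ "{1..D}" "{1..A}"])
  also have "\<dots> = (\<Sum>d\<in>{1..D}. moebius d *
      ((\<Sum>a\<in>{1..A}. if d dvd a then f a else 0) * (\<Sum>b\<in>{1..B}. if d dvd b then g b else 0)))"
    by (simp only: sum_product) (simp only: sum_distrib_left)
  also have "\<dots> = (\<Sum>d\<in>{1..D}. moebius d *
      ((\<Sum>a\<in>{1..A div d}. f (d * a)) * (\<Sum>b\<in>{1..B div d}. g (d * b))))"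
    by (intro sum.cong refl arg_cong2[where f = "(*)"] sum_multiples) auto
  finally show ?thesis .
qed

section \<open>The value zeta(2) and the partial sums of the Moebius series\<close>

text \<open>The term at \<open>N + 1\<close> is at most 1 / (N + 1), and the terms after it
  telescope to at most the same amount by 1 / (M + 1)^2 \<le> 1 / M - 1 / (M + 1). Hence the
  constant 2, and \<open>N = 0\<close> is no exception.\<close>

lemma riemann_zeta_2_bounds:
  shows "(\<Sum>n\<in>{1..N}. 1 / real n ^ 2) \<le> riemann_zeta 2"
    and "riemann_zeta 2 \<le> (\<Sum>n\<in>{1..N}. 1 / real n ^ 2) + 2 / real (N + 1)"
proof -
  have "real (Suc n) powr 2 = real (Suc n) ^ 2" for n
    using powr_realpow[of "real (Suc n)" 2] by simp
  then have eq: "riemann_zeta 2 = (\<Sum>n. 1 / real (Suc n) ^ 2)"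
    unfolding riemann_zeta_def by presburger
  have idx: "(\<Sum>n\<in>{1..M}. 1 / real n ^ 2) = (\<Sum>n<M. 1 / real (Suc n) ^ 2)" for M
    by (rule sum.reindex_bij_witness[of _ Suc "\<lambda>n. n - 1"]) auto
  have tele: "(\<Sum>n<M. 1 / real (Suc n) ^ 2) \<le> (\<Sum>n<N. 1 / real (Suc n) ^ 2) + 2 / real (N + 1)
      - 1 / real M" if "Suc N \<le> M" for M
    using that
  proof (induction M rule: dec_induct)
    case base
    have "1 / real (Suc N) ^ 2 \<le> 1 / real (Suc N)" by (simp add: power2_eq_square divide_simps)
    then show ?case by simp
  next
    case (step M)
    have "M > 0" using step by simp
    then have "1 / real (Suc M) ^ 2 \<le> 1 / real M - 1 / real (Suc M)"
      by (simp add: power2_eq_square divide_simps)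
    then show ?case using step by simp
  qed
  have bound: "(\<Sum>n<M. 1 / real (Suc n) ^ 2) \<le> (\<Sum>n<N. 1 / real (Suc n) ^ 2) + 2 / real (N + 1)" for M
  proof -
    have "(\<Sum>n<M. 1 / real (Suc n) ^ 2) \<le> (\<Sum>n<max M (Suc N). 1 / real (Suc n) ^ 2)"
      by (rule sum_mono2) auto
    also have "\<dots> \<le> (\<Sum>n<N. 1 / real (Suc n) ^ 2) + 2 / real (N + 1) - 1 / real (max M (Suc N))"
      by (rule tele) simp
    also have "\<dots> \<le> (\<Sum>n<N. 1 / real (Suc n) ^ 2) + 2 / real (N + 1)"
      by simp
    finally show ?thesis .
  qed
  have sm: "summable (\<lambda>n. 1 / real (Suc n) ^ 2)"
    by (rule summableI_nonneg_bounded[OF _ bound]) simp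
  show "(\<Sum>n\<in>{1..N}. 1 / real n ^ 2) \<le> riemann_zeta 2"
    unfolding eq idx by (rule sum_le_suminf[OF sm]) auto
  show "riemann_zeta 2 \<le> (\<Sum>n\<in>{1..N}. 1 / real n ^ 2) + 2 / real (N + 1)"
    unfolding eq idx by (rule suminf_le_const[OF sm bound])
qed

lemma riemann_zeta_2_ge_1: "riemann_zeta 2 \<ge> 1"
  using riemann_zeta_2_bounds(1)[of 1] by simp

text \<open>
  The extra summand \<open>1\<close> on the right only serves the case \<open>D = 0\<close>. Otherwise, the sums of
  \<open>moebius d / d\<^sup>2\<close> times the partial zeta sums up to \<open>D div d\<close> add up to exactly \<open>1\<close>, and completing
  the zeta sum in each term costs at most \<open>2 / ((D + 1) * d)\<close>.
\<close>

lemma sum_moebius_over_square: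
  "\<bar>(\<Sum>d\<in>{1..D}. moebius d / real d ^ 2) - 1 / riemann_zeta 2\<bar>
     \<le> 2 * (1 + (\<Sum>d\<in>{1..D}. 1 / real d)) / real (D + 1)"
proof (cases "D = 0")
  case True
  have "0 \<le> 1 / riemann_zeta 2" "1 / riemann_zeta 2 \<le> 1" using riemann_zeta_2_ge_1 by simp_all
  then show ?thesis using True by simp
next
  case False
  define z where "z = riemann_zeta 2"
  define Z where "Z N = (\<Sum>k\<in>{1..N}. 1 / real k ^ 2)" for N
  \<comment> \<open>\<open>Z (D div d)\<close> divided by d^2 is the sum of 1 / n^2 over the
    multiples \<open>n\<close> of \<open>d\<close> up to \<open>D\<close>. After exchanging the
    sums, the divisor sum of \<open>moebius\<close> leaves only \<open>n = 1\<close>.\<close>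
  have "(\<Sum>d\<in>{1..D}. moebius d / real d ^ 2 * Z (D div d)) =
      (\<Sum>d\<in>{1..D}. moebius d * (\<Sum>n\<in>{1..D div d}. 1 / real (d * n) ^ 2))"
    unfolding Z_def by (simp add: sum_distrib_left power_mult_distrib)
  also have "\<dots> = (\<Sum>d\<in>{1..D}. moebius d * (\<Sum>n\<in>{1..D}. if d dvd n then 1 / real n ^ 2 else 0))"
    by (intro sum.cong refl)
      (subst sum_multiples[where f = "\<lambda>n. 1 / real n ^ 2"], auto)
  also have "\<dots> = (\<Sum>n\<in>{1..D}. \<Sum>d\<in>{1..D}. (if d dvd n then moebius d else 0) * (1 / real n ^ 2))"
    unfolding sum_distrib_left by (subst sum.swap) (intro sum.cong refl, auto)
  also have "\<dots> = (\<Sum>n\<in>{1..D}. (if n = 1 then 1 else 0) * (1 / real n ^ 2))"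
    unfolding sum_distrib_right[symmetric]
    by (intro sum.cong refl arg_cong2[where f = "(*)"] sum_moebius_atLeastAtMost) auto
  also have "\<dots> = (\<Sum>n\<in>{1..D}. if n = 1 then 1 else 0)"
    by (intro sum.cong) auto
  also have "\<dots> = 1" using False by (simp add: sum.delta)
  finally have one: "(\<Sum>d\<in>{1..D}. moebius d / real d ^ 2 * Z (D div d)) = 1" .
  have z1: "z \<ge> 1" using riemann_zeta_2_ge_1 by (simp add: z_def)
  \<comment> \<open>Multiplying by \<open>z \<ge> 1\<close> clears the quotient 1 / z and can only
    enlarge the left side; the 1 that remains is then replaced by the identity
    \<open>one\<close>.\<close>
  have "\<bar>(\<Sum>d\<in>{1..D}. moebius d / real d ^ 2) - 1 / z\<bar>
      \<le> z * \<bar>(\<Sum>d\<in>{1..D}. moebius d / real d ^ 2) - 1 / z\<bar>"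
    using z1 by (simp add: mult_le_cancel_right1)
  also have "\<dots> = \<bar>(\<Sum>d\<in>{1..D}. moebius d / real d ^ 2) * z - 1\<bar>"
    using z1 by (simp add: abs_mult[of z, symmetric, unfolded abs_of_pos] abs_if field_simps)
  also have "\<dots> = \<bar>\<Sum>d\<in>{1..D}. moebius d / real d ^ 2 * (z - Z (D div d))\<bar>"
    using one by (simp add: right_diff_distrib sum_subtractf sum_distrib_right)
  also have "\<dots> \<le> (\<Sum>d\<in>{1..D}. \<bar>moebius d / real d ^ 2 * (z - Z (D div d))\<bar>)"
    by (rule sum_abs)
  also have "\<dots> \<le> (\<Sum>d\<in>{1..D}. 1 / real d ^ 2 * (2 * real d / real (D + 1)))"
  proof (rule sum_mono)
    fix d assume d: "d \<in> {1..D}"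
    \<comment> \<open>This turns the zeta tail 2 / (D div d + 1) into a bound without integer
      division.\<close>
    have "D + 1 \<le> d * (D div d + 1)"
      using d by (simp add: Suc_le_eq dividend_less_times_div)
    then have "real (D + 1) \<le> real d * real (D div d + 1)"
      by (metis of_nat_le_iff of_nat_mult)
    then have "2 / real (D div d + 1) \<le> 2 * real d / real (D + 1)"
      by (simp add: field_simps)
    then have zz: "\<bar>z - Z (D div d)\<bar> \<le> 2 * real d / real (D + 1)"
      using riemann_zeta_2_bounds[of "D div d"] unfolding z_def Z_def by linarith
    have "\<bar>moebius d / real d ^ 2\<bar> \<le> 1 / real d ^ 2"
      using abs_moebius_le_1[of d] d by (simp add: divide_right_mono)
    with zz show "\<bar>moebius d / real d ^ 2 * (z - Z (D div d))\<bar>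
        \<le> 1 / real d ^ 2 * (2 * real d / real (D + 1))"
      unfolding abs_mult by (intro mult_mono) auto
  qed
  also have "\<dots> = 2 * (\<Sum>d\<in>{1..D}. 1 / real d) / real (D + 1)"
    unfolding sum_distrib_left sum_divide_distrib
    by (intro sum.cong) (auto simp: power2_eq_square)
  also have "\<dots> \<le> 2 * (1 + (\<Sum>d\<in>{1..D}. 1 / real d)) / real (D + 1)"
    by (intro divide_right_mono) auto
  finally show ?thesis unfolding z_def .
qed

section \<open>Power sums along arithmetic progressions and over coprime pairs\<close>

text \<open>A Riemann sum comparison for the k-th power on the interval from 0 to \<open>X\<close>
  with mesh \<open>c\<close>. The hypotheses say that \<open>A\<close> is the integer part of X / c,
  so the piece left over at 0 is shorter than one mesh.\<close>

lemma sum_powers_arith_bounds: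
  fixes X c :: real
  assumes "c > 0" "real A * c \<le> X" "X < real (A + 1) * c"
  shows "(\<Sum>a\<in>{1..A}. (X - real a * c) ^ k) \<le> X ^ (k + 1) / (real (k + 1) * c)"
    and "X ^ (k + 1) / (real (k + 1) * c) - X ^ k \<le> (\<Sum>a\<in>{1..A}. (X - real a * c) ^ k)"
proof -
  \<comment> \<open>The mean value bounds: the difference of powers is \<open>v - u\<close> times
    \<open>k + 1\<close> terms, each between u^k and v^k.\<close>
  have pw: "real (k + 1) * (v - u) * u ^ k \<le> v ^ (k + 1) - u ^ (k + 1)"
           "v ^ (k + 1) - u ^ (k + 1) \<le> real (k + 1) * (v - u) * v ^ k"
    if "0 \<le> u" "u \<le> v" for u v :: real
  proof -
    have *: "v ^ (k + 1) - u ^ (k + 1) = (v - u) * (\<Sum>i<k + 1. u ^ (k - i) * v ^ i)"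
      using power_diff_sumr2[of v "k + 1" u] by simp
    have "(\<Sum>i<k + 1. u ^ (k - i) * v ^ i) \<ge> (\<Sum>i<k + 1. u ^ (k - i) * u ^ i)"
      using that by (intro sum_mono mult_left_mono power_mono) auto
    also have "(\<Sum>i<k + 1. u ^ (k - i) * u ^ i) = (\<Sum>i<k + 1. u ^ k)"
      by (intro sum.cong) (auto simp: power_add[symmetric])
    finally show "real (k + 1) * (v - u) * u ^ k \<le> v ^ (k + 1) - u ^ (k + 1)"
      unfolding * using that by (simp add: mult_left_mono mult.assoc mult.left_commute)
    have "(\<Sum>i<k + 1. u ^ (k - i) * v ^ i) \<le> (\<Sum>i<k + 1. v ^ (k - i) * v ^ i)"
      using that by (intro sum_mono mult_right_mono power_mono) auto
    also have "(\<Sum>i<k + 1. v ^ (k - i) * v ^ i) = (\<Sum>i<k + 1. v ^ k)"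
      by (intro sum.cong) (auto simp: power_add[symmetric])
    finally show "v ^ (k + 1) - u ^ (k + 1) \<le> real (k + 1) * (v - u) * v ^ k"
      unfolding * using that by (simp add: mult_left_mono mult.assoc mult.left_commute)
  qed
  define w where "w = X - real A * c"
  have w: "0 \<le> w" "w \<le> c" using assms by (auto simp: w_def algebra_simps)
  \<comment> \<open>The upper Riemann sum runs over \<open>a\<close> from 0 to \<open>B - 1\<close>;
    it is written as the sum from 1 to \<open>B\<close> plus the term at 0 minus the term at
    \<open>B\<close>.\<close>
  have tele: "real (k + 1) * c * (\<Sum>a\<in>{1..B}. (X - real a * c) ^ k) \<le> X ^ (k + 1) - (X - real B * c) ^ (k + 1)
    \<and> X ^ (k + 1) - (X - real B * c) ^ (k + 1) \<le>
        real (k + 1) * c * (X ^ k + (\<Sum>a\<in>{1..B}. (X - real a * c) ^ k) - (X - real B * c) ^ k)"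
    if "B \<le> A" for B
    using that
  proof (induction B)
    case 0
    then show ?case by simp
  next
    case (Suc B)
    define u where "u = X - real (Suc B) * c"
    have "real (Suc B) * c \<le> real A * c" using Suc assms by (intro mult_right_mono) auto
    then have u: "0 \<le> u" using assms unfolding u_def by linarith
    have v: "X - real B * c = u + c" by (simp add: u_def algebra_simps)
    have s: "(\<Sum>a\<in>{1..Suc B}. (X - real a * c) ^ k) = (\<Sum>a\<in>{1..B}. (X - real a * c) ^ k) + u ^ k"
      by (simp add: u_def)
    show ?case
      using Suc pw[of u "u + c"] u assms(1)
      unfolding s u_def[symmetric] v by (simp only: distrib_left right_diff_distrib) simp
  qed
  \<comment> \<open>The leftover piece is paid for by the term at \<open>B = A\<close> that
    \<open>tele\<close> subtracts, because \<open>w \<le> c\<close>.\<close>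
  have "w ^ (k + 1) \<le> real (k + 1) * c * w ^ k"
  proof -
    have "w ^ (k + 1) \<le> c * w ^ k" using w by (simp add: mult_right_mono)
    also have "\<dots> \<le> real (k + 1) * (c * w ^ k)" using w assms(1) mult_right_mono[of 1 "real (k + 1)" "c * w ^ k"] by simp
    finally show ?thesis by (simp add: mult.assoc)
  qed
  moreover have "w ^ (k + 1) \<ge> 0" using w by simp
  ultimately have
    "real (k + 1) * c * (\<Sum>a\<in>{1..A}. (X - real a * c) ^ k) \<le> X ^ (k + 1)"
    "X ^ (k + 1) \<le> real (k + 1) * c * (X ^ k + (\<Sum>a\<in>{1..A}. (X - real a * c) ^ k))"
    using tele[of A] unfolding w_def[symmetric] by (simp_all only: distrib_left right_diff_distrib) auto
  moreover have "real (k + 1) * c > 0" using assms by simp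
  ultimately show "(\<Sum>a\<in>{1..A}. (X - real a * c) ^ k) \<le> X ^ (k + 1) / (real (k + 1) * c)"
    and "X ^ (k + 1) / (real (k + 1) * c) - X ^ k \<le> (\<Sum>a\<in>{1..A}. (X - real a * c) ^ k)"
    by (simp_all add: pos_le_divide_eq pos_divide_le_eq mult.commute diff_le_eq add.commute)
qed

text \<open>Induction with 1 / (D + 1) \<le> ln (D + 1) - ln D, which is ln t \<le> t - 1 at t = D /
  (D + 1).\<close>

lemma sum_inverse_le_ln:
  assumes "D > 0"
  shows "(\<Sum>d\<in>{1..D}. 1 / real d) \<le> 1 + ln (real D)"
  using assms
proof (induction D rule: nat_induct_non_zero)
  case 1
  then show ?case by simp
next
  case (Suc D)
  have "ln (real D / real (Suc D)) \<le> real D / real (Suc D) - 1"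
    using Suc by (intro ln_le_minus_one) auto
  also have "\<dots> = - (1 / real (Suc D))" by (simp add: field_simps)
  finally have "1 / real (Suc D) \<le> ln (real (Suc D)) - ln (real D)"
    using Suc by (simp add: ln_div del: of_nat_Suc)
  then show ?case using Suc by simp
qed

text \<open>These are the conditions that \<open>sum_powers_arith_bounds\<close> places on
  \<open>A\<close>.\<close>

lemma nat_floor_divide_bounds:
  fixes X c :: real
  assumes "c > 0" "X \<ge> 0"
  shows "real (nat \<lfloor>X / c\<rfloor>) * c \<le> X" "X < real (nat \<lfloor>X / c\<rfloor> + 1) * c"
proof -
  have "real (nat \<lfloor>X / c\<rfloor>) \<le> X / c" "X / c < real (nat \<lfloor>X / c\<rfloor> + 1)"
    using assms real_of_int_floor_add_one_gt[of "X / c"] by (simp_all add: add.commute of_nat_floor)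
  then show "real (nat \<lfloor>X / c\<rfloor>) * c \<le> X" "X < real (nat \<lfloor>X / c\<rfloor> + 1) * c"
    using assms(1) by (simp_all only: pos_le_divide_eq pos_divide_less_eq)
qed

text \<open>Two errors of the same order T^(2k + 1) (1 + H) / c arise, with \<open>H\<close> the
  harmonic sum up to \<open>D\<close>: \<open>e1\<close> from replacing the inner sums by their main
  terms, \<open>e2\<close> from cutting the series for 1 / zeta(2) at \<open>D\<close>. The constant
  is uniform in \<open>X\<close> and \<open>Y\<close> up to \<open>T\<close>, as the induction over
  the primes requires.\<close>

lemma sum_coprime_powers_bound:
  fixes c :: real
  assumes c: "c > 0"
  obtains K where "K \<ge> 0" and "\<And>T X Y. 2 \<le> T \<Longrightarrow> 0 \<le> X \<Longrightarrow> X \<le> T \<Longrightarrow> 0 \<le> Y \<Longrightarrow> Y \<le> T \<Longrightarrow>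
    \<bar>(\<Sum>a\<in>{1..nat \<lfloor>X / c\<rfloor>}. \<Sum>b\<in>{1..nat \<lfloor>Y / c\<rfloor>}.
        if coprime a b then (X - real a * c) ^ k * (Y - real b * c) ^ k else 0)
      - X ^ (k + 1) * Y ^ (k + 1) / ((real (k + 1) * c)\<^sup>2 * riemann_zeta 2)\<bar>
    \<le> K * T ^ (2 * k + 1) * ln T"
proof
  \<comment> \<open>Each of \<open>e1\<close> and \<open>e2\<close> contributes 2 / c. The other
    factor bounds \<open>1 + H\<close> by a multiple of \<open>ln T\<close>: the constant part
    \<open>2 + \<bar>ln c\<bar>\<close> is absorbed by \<open>ln T \<ge> ln 2\<close>.\<close>
  define K where "K = 4 / c * ((2 + \<bar>ln c\<bar>) / ln 2 + 1)"
  show "K \<ge> 0" unfolding K_def using c by simp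
  fix T X Y :: real
  assume T: "2 \<le> T" and X: "0 \<le> X" "X \<le> T" and Y: "0 \<le> Y" "Y \<le> T"
  \<comment> \<open>Taking the cutoff from \<open>T\<close> covers all exponents allowed by
    \<open>X\<close> and gives 1 / (D + 1) \<le> c / T.\<close>
  define D where "D = nat \<lfloor>T / c\<rfloor>"
  define H where "H = (\<Sum>d\<in>{1..D}. 1 / real d)"
  define g where "g Z d = (\<Sum>a\<in>{1..nat \<lfloor>Z / c\<rfloor> div d}. (Z - real (d * a) * c) ^ k)" for Z d
  define m where "m Z d = Z ^ (k + 1) / (real (k + 1) * (real d * c))" for Z d
  define S where "S = (\<Sum>d\<in>{1..D}. moebius d / real d ^ 2)"
  define z where "z = riemann_zeta 2"
  define V where "V = X ^ (k + 1) * Y ^ (k + 1) / (real (k + 1) * c)\<^sup>2"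
  have W: "(\<Sum>a\<in>{1..nat \<lfloor>X / c\<rfloor>}. \<Sum>b\<in>{1..nat \<lfloor>Y / c\<rfloor>}.
        if coprime a b then (X - real a * c) ^ k * (Y - real b * c) ^ k else 0)
      = (\<Sum>d\<in>{1..D}. moebius d * (g X d * g Y d))"
    unfolding g_def
  proof (rule sum_coprime_moebius)
    show "nat \<lfloor>X / c\<rfloor> \<le> D"
      unfolding D_def using X c by (intro nat_mono floor_mono divide_right_mono) auto
  qed
  have g: "0 \<le> g Z d" "g Z d \<le> m Z d" "m Z d - g Z d \<le> T ^ k" "m Z d \<le> T ^ (k + 1) / (real d * c)"
    if Z: "0 \<le> Z" "Z \<le> T" and d: "d > 0" for Z d
  proof -
    \<comment> \<open>Nested floors collapse, so the multiples of \<open>d\<close> form a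
      progression of mesh \<open>d * c\<close> that stops exactly where the power sum bounds
      require.\<close>
    have fl: "nat \<lfloor>Z / c\<rfloor> div d = nat \<lfloor>Z / (real d * c)\<rfloor>"
      using floor_divide_real_eq_div[of "int d" "Z / c"]
      by (simp add: nat_div_distrib' mult.commute)
    have dc: "real d * c > 0" using c d by simp
    have geq: "g Z d = (\<Sum>a\<in>{1..nat \<lfloor>Z / (real d * c)\<rfloor>}. (Z - real a * (real d * c)) ^ k)"
      unfolding g_def fl by (simp add: mult_ac)
    note fb = nat_floor_divide_bounds[OF dc Z(1)]
    note b = sum_powers_arith_bounds[OF dc fb, of k, folded geq m_def]
    show "g Z d \<le> m Z d" by (rule b)
    have "Z ^ k \<le> T ^ k" using Z by (intro power_mono)
    with b show "m Z d - g Z d \<le> T ^ k" by linarith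
    show "0 \<le> g Z d" unfolding geq
    proof (intro sum_nonneg zero_le_power)
      fix a assume "a \<in> {1..nat \<lfloor>Z / (real d * c)\<rfloor>}"
      then have "real a * (real d * c) \<le> real (nat \<lfloor>Z / (real d * c)\<rfloor>) * (real d * c)"
        using dc by (intro mult_right_mono) auto
      with fb show "0 \<le> Z - real a * (real d * c)" by linarith
    qed
    have "m Z d \<le> T ^ (k + 1) / (1 * (real d * c))"
      unfolding m_def using Z dc by (intro frac_le power_mono mult_right_mono) auto
    then show "m Z d \<le> T ^ (k + 1) / (real d * c)" by simp
  qed
  have err: "\<bar>g X d * g Y d - m X d * m Y d\<bar> \<le> 2 * T ^ (2 * k + 1) / c * (1 / real d)"
    if d: "d > 0" for d
  proof -
    note gX = g[OF X d] and gY = g[OF Y d]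
    have "g X d * g Y d \<le> m X d * m Y d" using gX gY by (intro mult_mono) auto
    \<comment> \<open>Changing one factor at a time leaves a main term of size T^(k + 1) / (d c)
      times an error of size T^k, hence the factor 1 / d.\<close>
    then have "\<bar>g X d * g Y d - m X d * m Y d\<bar> = m X d * (m Y d - g Y d) + g Y d * (m X d - g X d)"
      by (simp add: algebra_simps)
    also have "\<dots> \<le> T ^ (k + 1) / (real d * c) * T ^ k + T ^ (k + 1) / (real d * c) * T ^ k"
      using gX gY by (intro add_mono mult_mono) auto
    also have "\<dots> = 2 * (T ^ (k + 1) * T ^ k) / c * (1 / real d)"
      by simp
    also have "T ^ (k + 1) * T ^ k = T ^ (2 * k + 1)"
      unfolding power_add[symmetric] by (rule arg_cong[of _ _ "(^) T"]) simp
    finally show ?thesis .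
  qed
  have mm: "(\<Sum>d\<in>{1..D}. moebius d * (m X d * m Y d)) = V * S"
    unfolding S_def sum_distrib_left V_def m_def
    by (intro sum.cong) (auto simp: power2_eq_square mult_ac)
  have H0: "H \<ge> 0" unfolding H_def by (intro sum_nonneg) auto
  have e1: "\<bar>(\<Sum>d\<in>{1..D}. moebius d * (g X d * g Y d)) - V * S\<bar> \<le> 2 * T ^ (2 * k + 1) / c * (1 + H)"
  proof -
    have "\<bar>(\<Sum>d\<in>{1..D}. moebius d * (g X d * g Y d)) - V * S\<bar>
        = \<bar>\<Sum>d\<in>{1..D}. moebius d * (g X d * g Y d - m X d * m Y d)\<bar>"
      unfolding mm[symmetric] by (simp add: right_diff_distrib sum_subtractf)
    also have "\<dots> \<le> (\<Sum>d\<in>{1..D}. \<bar>moebius d * (g X d * g Y d - m X d * m Y d)\<bar>)"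
      by (rule sum_abs)
    also have "\<dots> \<le> (\<Sum>d\<in>{1..D}. 1 * (2 * T ^ (2 * k + 1) / c * (1 / real d)))"
      unfolding abs_mult using abs_moebius_le_1 err by (intro sum_mono mult_mono) auto
    also have "\<dots> = 2 * T ^ (2 * k + 1) / c * H"
      unfolding H_def sum_distrib_left by simp
    also have "\<dots> \<le> 2 * T ^ (2 * k + 1) / c * (1 + H)"
      using c T by (intro mult_left_mono) auto
    finally show ?thesis .
  qed
  have Vb: "\<bar>V\<bar> \<le> T ^ (2 * k + 2) / c\<^sup>2"
  proof -
    have "V \<le> (T ^ (k + 1) * T ^ (k + 1)) / (1 * c)\<^sup>2"
      unfolding V_def using X Y c T by (intro frac_le power_mono mult_mono) auto
    moreover have "V \<ge> 0" unfolding V_def using X Y by simp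
    moreover have "T ^ (k + 1) * T ^ (k + 1) = T ^ (2 * k + 2)"
      unfolding power_add[symmetric] by (rule arg_cong[of _ _ "(^) T"]) simp
    ultimately show ?thesis by (simp only: mult_1 abs_of_nonneg)
  qed
  have D1: "1 / real (D + 1) \<le> c / T"
    using nat_floor_divide_bounds(2)[OF c, of T] T unfolding D_def by (simp add: field_simps)
  \<comment> \<open>\<open>V\<close> may be one power of \<open>T\<close> too large; the factor 1 /
    (D + 1) \<le> c / T gains it back.\<close>
  have e2: "\<bar>V * S - V / z\<bar> \<le> 2 * T ^ (2 * k + 1) / c * (1 + H)"
  proof -
    have "\<bar>V * S - V / z\<bar> = \<bar>V\<bar> * \<bar>S - 1 / z\<bar>"
      unfolding abs_mult[symmetric] by (simp add: right_diff_distrib)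
    also have "\<dots> \<le> T ^ (2 * k + 2) / c\<^sup>2 * (2 * (1 + H) * (1 / real (D + 1)))"
      using sum_moebius_over_square[of D, folded S_def z_def H_def] Vb
      by (intro mult_mono) auto
    also have "\<dots> \<le> T ^ (2 * k + 2) / c\<^sup>2 * (2 * (1 + H) * (c / T))"
      using D1 H0 T c by (intro mult_left_mono) auto
    also have "\<dots> = 2 * T ^ (2 * k + 1) / c * (1 + H)"
      using T c by (simp add: power2_eq_square field_simps)
    finally show ?thesis .
  qed
  have lnT: "ln T \<ge> ln 2" using T by simp
  have "H \<le> 1 + \<bar>ln c\<bar> + ln T"
  proof (cases "D = 0")
    case True
    then show ?thesis unfolding H_def using T by simp
  next
    case False
    have "real D \<le> T / c"
      using nat_floor_divide_bounds(1)[OF c, of T] T c unfolding D_def by (simp add: pos_le_divide_eq)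
    then have "ln (real D) \<le> ln T - ln c"
      using False T c ln_mono[of "real D" "T / c"] by (simp add: ln_div)
    then show ?thesis using sum_inverse_le_ln[of D] False unfolding H_def by linarith
  qed
  also have "1 + \<bar>ln c\<bar> + ln T \<le> ((2 + \<bar>ln c\<bar>) / ln 2 + 1) * ln T - 1"
  proof -
    have "(2 + \<bar>ln c\<bar>) / ln 2 * ln 2 \<le> (2 + \<bar>ln c\<bar>) / ln 2 * ln T"
      using lnT by (intro mult_left_mono) auto
    moreover have "(2 + \<bar>ln c\<bar>) / ln 2 * ln 2 = 2 + \<bar>ln c\<bar>" by simp
    ultimately show ?thesis unfolding distrib_right by linarith
  qed
  finally have HB: "1 + H \<le> ((2 + \<bar>ln c\<bar>) / ln 2 + 1) * ln T" by simp
  have "\<bar>(\<Sum>d\<in>{1..D}. moebius d * (g X d * g Y d)) - V / z\<bar> \<le> 4 * T ^ (2 * k + 1) / c * (1 + H)"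
    using e1 e2 by linarith
  also have "\<dots> \<le> 4 * T ^ (2 * k + 1) / c * (((2 + \<bar>ln c\<bar>) / ln 2 + 1) * ln T)"
    using HB c T by (intro mult_left_mono) auto
  also have "\<dots> = K * T ^ (2 * k + 1) * ln T" unfolding K_def by simp
  finally show "\<bar>(\<Sum>a\<in>{1..nat \<lfloor>X / c\<rfloor>}. \<Sum>b\<in>{1..nat \<lfloor>Y / c\<rfloor>}.
        if coprime a b then (X - real a * c) ^ k * (Y - real b * c) ^ k else 0)
      - X ^ (k + 1) * Y ^ (k + 1) / ((real (k + 1) * c)\<^sup>2 * riemann_zeta 2)\<bar>
    \<le> K * T ^ (2 * k + 1) * ln T"
    unfolding W V_def z_def by simp
qed

section \<open>Counting pairs by induction on the set of primes\<close>

text \<open>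
  Unlike \<open>exp_coprime_pairs\<close>, this allows \<open>S = {}\<close>, where the only pair is \<open>(1, 1)\<close>,
  and two different bounds, which are logarithmic.
\<close>

definition coprime_pairs :: "nat set \<Rightarrow> real \<Rightarrow> real \<Rightarrow> (nat \<times> nat) set" where
  "coprime_pairs S X Y = {(n, m). n > 0 \<and> m > 0 \<and> prime_factors n = S \<and> prime_factors m = S \<and>
     (\<forall>q\<in>S. coprime (multiplicity q n) (multiplicity q m)) \<and> ln (real n) \<le> X \<and> ln (real m) \<le> Y}"

lemma finite_coprime_pairs: "finite (coprime_pairs S X Y)"
proof (rule finite_subset)
  have "n \<le> nat \<lfloor>exp Z\<rfloor>" if "n > 0" "ln (real n) \<le> Z" for n Z
    using that by (intro le_nat_floor) (metis exp_le_cancel_iff exp_ln of_nat_0_less_iff)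
  then show "coprime_pairs S X Y \<subseteq> {..nat \<lfloor>exp X\<rfloor>} \<times> {..nat \<lfloor>exp Y\<rfloor>}"
    by (auto simp: coprime_pairs_def)
qed auto

text \<open>Splitting off the powers of \<open>q\<close> is a bijection from pairs of coprime
  positive exponents together with a pair for \<open>S\<close>. Taking logarithms, a factor q^a
  lowers the bound by \<open>a * c\<close>.\<close>

lemma card_coprime_pairs_insert:
  fixes q :: nat
  assumes q: "prime q" "q \<notin> S" and XY: "X \<ge> 0" "Y \<ge> 0"
  defines "c \<equiv> ln (real q)"
  shows "card (coprime_pairs (insert q S) X Y) =
    (\<Sum>a\<in>{1..nat \<lfloor>X / c\<rfloor>}. \<Sum>b\<in>{1..nat \<lfloor>Y / c\<rfloor>}.
       if coprime a b then card (coprime_pairs S (X - real a * c) (Y - real b * c)) else 0)"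
proof -
  have q2: "q \<ge> 2" using q(1) by (rule prime_ge_2_nat)
  then have c: "c > 0" by (simp add: c_def)
  define Q where "Q n \<longleftrightarrow> n > 0 \<and> prime_factors n = S" for n :: nat
  have pf: "prime_factors (q ^ a * e) = insert q (prime_factors e)" if "a > 0" "e > 0" for a e
    using that q(1) q2
    by (auto simp: in_prime_factors_iff prime_dvd_mult_iff prime_dvd_power_iff primes_dvd_imp_eq)
  have Q: "q ^ a * n > 0" "prime_factors (q ^ a * n) = insert q S" "multiplicity q (q ^ a * n) = a"
      "q ^ a * n div q ^ a = n" "ln (real (q ^ a * n)) = real a * c + ln (real n)"
      "\<And>p. p \<in> S \<Longrightarrow> multiplicity p (q ^ a * n) = multiplicity p n"
    if "Q n" "a > 0" for a n
  proof -
    have n: "n > 0" "prime_factors n = S" using that by (auto simp: Q_def)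
    have ndvd: "\<not> q dvd n" using n q by (auto simp: in_prime_factors_iff)
    show "q ^ a * n > 0" "q ^ a * n div q ^ a = n" using n q2 by auto
    show "prime_factors (q ^ a * n) = insert q S"
      using pf n \<open>a > 0\<close> by simp
    show "multiplicity q (q ^ a * n) = a"
      using ndvd q2 by (intro multiplicity_eqI) auto
    show "ln (real (q ^ a * n)) = real a * c + ln (real n)"
      using n q2 by (simp add: ln_mult ln_realpow c_def)
    fix p assume p: "p \<in> S"
    then have "prime p" "p \<noteq> q" using n q by (auto simp: in_prime_factors_iff)
    then show "multiplicity p (q ^ a * n) = multiplicity p n"
      using q n q2 by (simp add: prime_elem_multiplicity_mult_distrib prime_elem_multiplicity_power_distrib
         prime_multiplicity_other)
  qed
  have R: "\<exists>a e. n = q ^ a * e \<and> a > 0 \<and> Q e" if "n > 0" "prime_factors n = insert q S" for n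
  proof -
    have "n \<noteq> 0" "\<not> is_unit q" using that q2 by auto
    then obtain e where e: "n = q ^ multiplicity q n * e" "\<not> q dvd e"
      using multiplicity_decompose' by blast
    have a: "multiplicity q n > 0"
      using that(2) by (metis insertI1 prime_factors_multiplicity mem_Collect_eq)
    have "e > 0" using e(2) by (metis dvd_0_right gr0I)
    have "prime_factors n = insert q (prime_factors e)"
      using pf[OF a \<open>e > 0\<close>] e(1) by simp
    moreover have "q \<notin> prime_factors e" using e by auto
    ultimately have "Q e" using that q \<open>e > 0\<close> unfolding Q_def by (metis insert_ident)
    with e a show ?thesis by blast
  qed
  \<comment> \<open>The cofactor is at least 1, so its logarithm is nonnegative and the finite
    ranges for \<open>a\<close> and \<open>b\<close> lose no pair.\<close>
  have fl: "a \<le> nat \<lfloor>Z / c\<rfloor>" if "Q e" "real a * c + ln (real e) \<le> Z" for a e Z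
  proof -
    have "ln (real e) \<ge> 0" using that by (simp add: Q_def)
    then have "real a \<le> Z / c" using c that by (simp add: pos_le_divide_eq)
    then show ?thesis by (simp add: le_nat_floor)
  qed
  let ?I = "{(a, b). a \<in> {1..nat \<lfloor>X / c\<rfloor>} \<and> b \<in> {1..nat \<lfloor>Y / c\<rfloor>} \<and> coprime a b}"
  let ?F = "\<lambda>(a, b). coprime_pairs S (X - real a * c) (Y - real b * c)"
  have finI: "finite ?I"
    by (rule finite_subset[of _ "{1..nat \<lfloor>X / c\<rfloor>} \<times> {1..nat \<lfloor>Y / c\<rfloor>}"]) auto
  define f :: "(nat \<times> nat) \<times> (nat \<times> nat) \<Rightarrow> nat \<times> nat" where
    "f = (\<lambda>((a, b), (n, m)). (q ^ a * n, q ^ b * m))"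
  \<comment> \<open>The left inverse of \<open>f\<close>, reading the exponents off as
    multiplicities of \<open>q\<close>; it yields injectivity.\<close>
  define g :: "nat \<times> nat \<Rightarrow> (nat \<times> nat) \<times> (nat \<times> nat)" where
    "g = (\<lambda>(n, m). ((multiplicity q n, multiplicity q m),
      (n div q ^ multiplicity q n, m div q ^ multiplicity q m)))"
  have *: "Q n \<and> Q m \<and> a > 0 \<and> b > 0" if "((a, b), (n, m)) \<in> Sigma ?I ?F" for a b n m
    using that by (auto simp: coprime_pairs_def Q_def)
  have gf: "g (f t) = t" if t: "t \<in> Sigma ?I ?F" for t
  proof -
    obtain a b n m where tt: "t = ((a, b), (n, m))" by (metis surj_pair)
    show ?thesis
      using *[OF t[unfolded tt]] Q(3,4)[of n a] Q(3,4)[of m b] by (simp add: tt f_def g_def)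
  qed
  have sub: "f t \<in> coprime_pairs (insert q S) X Y" if t: "t \<in> Sigma ?I ?F" for t
  proof -
    obtain a b n m where tt: "t = ((a, b), (n, m))" by (metis surj_pair)
    have "coprime a b" "ln (real n) \<le> X - real a * c" "ln (real m) \<le> Y - real b * c"
         "\<forall>p\<in>S. coprime (multiplicity p n) (multiplicity p m)"
      using t by (simp_all add: tt coprime_pairs_def)
    then show ?thesis
      unfolding coprime_pairs_def tt f_def
      using *[OF t[unfolded tt]] Q(1,2,3,5,6)[of n a] Q(1,2,3,5,6)[of m b]
      by (simp del: of_nat_mult of_nat_power)
  qed
  have inv: "\<exists>a b e h. (n, m) = (q ^ a * e, q ^ b * h) \<and> ((a, b), (e, h)) \<in> Sigma ?I ?F"
    if nm: "(n, m) \<in> coprime_pairs (insert q S) X Y" for n m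
  proof -
    obtain a e where e: "n = q ^ a * e" "a > 0" "Q e"
      using R[of n] nm by (auto simp: coprime_pairs_def)
    obtain b h where h: "m = q ^ b * h" "b > 0" "Q h"
      using R[of m] nm by (auto simp: coprime_pairs_def)
    note Qe = Q(3,5,6)[OF e(3,2), folded e(1)] and Qf = Q(3,5,6)[OF h(3,2), folded h(1)]
    have l: "real a * c + ln (real e) \<le> X" "real b * c + ln (real h) \<le> Y"
      using nm Qe(2) Qf(2) by (auto simp: coprime_pairs_def)
    have cop: "\<forall>p\<in>insert q S. coprime (multiplicity p n) (multiplicity p m)"
      using nm by (auto simp: coprime_pairs_def)
    then have "coprime a b" using Qe(1) Qf(1) by auto
    moreover have "(e, h) \<in> coprime_pairs S (X - real a * c) (Y - real b * c)"
      using e h l cop Qe(3) Qf(3) by (auto simp: coprime_pairs_def Q_def)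
    ultimately have "((a, b), (e, h)) \<in> Sigma ?I ?F"
      using e h fl[OF e(3) l(1)] fl[OF h(3) l(2)] by auto
    then show ?thesis using e h by blast
  qed
  have "bij_betw f (Sigma ?I ?F) (coprime_pairs (insert q S) X Y)"
    unfolding bij_betw_def
  proof (intro conjI subset_antisym)
    show "inj_on f (Sigma ?I ?F)" by (rule inj_on_inverseI[where g = g]) (rule gf)
    show "f ` Sigma ?I ?F \<subseteq> coprime_pairs (insert q S) X Y" by (rule image_subsetI) (rule sub)
    show "coprime_pairs (insert q S) X Y \<subseteq> f ` Sigma ?I ?F"
    proof
      fix s assume s: "s \<in> coprime_pairs (insert q S) X Y"
      obtain n m where nm: "s = (n, m)" by (cases s)
      obtain a b e h where s: "(n, m) = (q ^ a * e, q ^ b * h)" "((a, b), (e, h)) \<in> Sigma ?I ?F"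
        using inv[OF s[unfolded nm]] by blast
      have "s = f ((a, b), (e, h))" using nm s(1) by (simp only: f_def prod.case)
      then show "s \<in> f ` Sigma ?I ?F" using s(2) by (rule image_eqI)
    qed
  qed
  then have "card (coprime_pairs (insert q S) X Y) = card (Sigma ?I ?F)"
    by (rule bij_betw_same_card[symmetric])
  also have "\<dots> = (\<Sum>i\<in>?I. card (?F i))"
    by (rule card_SigmaI[OF finI]) (auto simp: finite_coprime_pairs)
  also have "\<dots> = (\<Sum>i\<in>{i \<in> {1..nat \<lfloor>X / c\<rfloor>} \<times> {1..nat \<lfloor>Y / c\<rfloor>}. coprime (fst i) (snd i)}. card (?F i))"
    by (rule sum.cong) auto
  also have "\<dots> = (\<Sum>i\<in>{1..nat \<lfloor>X / c\<rfloor>} \<times> {1..nat \<lfloor>Y / c\<rfloor>}.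
       if coprime (fst i) (snd i) then card (?F i) else 0)"
    by (rule sum.inter_filter) simp
  finally show ?thesis
    by (simp only: sum.cartesian_product case_prod_unfold)
qed

text \<open>
  The factor \<open>T\<close> on the left avoids the exponent \<open>2 * card S - 1\<close>, which is truncated for \<open>S = {}\<close>.
\<close>

lemma coprime_pairs_asymp:
  assumes "finite S" "\<And>q. q \<in> S \<Longrightarrow> prime q"
  shows "\<exists>K\<ge>0. \<forall>T X Y. 2 \<le> T \<longrightarrow> 0 \<le> X \<longrightarrow> X \<le> T \<longrightarrow> 0 \<le> Y \<longrightarrow> Y \<le> T \<longrightarrow>
    T * \<bar>real (card (coprime_pairs S X Y))
      - (\<Prod>q\<in>S. 1 / (ln (real q))\<^sup>2) / ((fact (card S))\<^sup>2 * riemann_zeta 2 ^ card S)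
        * (X ^ card S * Y ^ card S)\<bar>
    \<le> K * T ^ (2 * card S) * ln T"
  using assms
proof (induction S rule: finite_induct)
  case empty
  have "coprime_pairs {} X Y = {(1, 1)}" if "X \<ge> 0" "Y \<ge> 0" for X Y
    using that by (auto simp: coprime_pairs_def prime_factorization_empty_iff)
  \<comment> \<open>Count and main term are both 1, so the error vanishes.\<close>
  then show ?case by (intro exI[of _ 0]) simp
next
  case (insert q S)
  define n where "n = card S"
  define C where "C = (\<Prod>q\<in>S. 1 / (ln (real q))\<^sup>2) / ((fact n)\<^sup>2 * riemann_zeta 2 ^ n)"
  define c where "c = ln (real q)"
  have q: "prime q" using insert by simp
  have c: "c > 0" unfolding c_def using prime_ge_2_nat[OF q] by simp
  obtain K where K: "K \<ge> 0"
    and IH: "\<And>T X Y. 2 \<le> T \<Longrightarrow> 0 \<le> X \<Longrightarrow> X \<le> T \<Longrightarrow> 0 \<le> Y \<Longrightarrow> Y \<le> T \<Longrightarrow>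
      T * \<bar>real (card (coprime_pairs S X Y)) - C * (X ^ n * Y ^ n)\<bar> \<le> K * T ^ (2 * n) * ln T"
    using insert unfolding n_def C_def by auto
  obtain K' where K': "K' \<ge> 0"
    and W: "\<And>T X Y. 2 \<le> T \<Longrightarrow> 0 \<le> X \<Longrightarrow> X \<le> T \<Longrightarrow> 0 \<le> Y \<Longrightarrow> Y \<le> T \<Longrightarrow>
    \<bar>(\<Sum>a\<in>{1..nat \<lfloor>X / c\<rfloor>}. \<Sum>b\<in>{1..nat \<lfloor>Y / c\<rfloor>}.
        if coprime a b then (X - real a * c) ^ n * (Y - real b * c) ^ n else 0)
      - X ^ (n + 1) * Y ^ (n + 1) / ((real (n + 1) * c)\<^sup>2 * riemann_zeta 2)\<bar>
    \<le> K' * T ^ (2 * n + 1) * ln T"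
    using sum_coprime_powers_bound[OF c] by blast
  have card: "card (insert q S) = n + 1" using insert by (simp add: n_def)
  \<comment> \<open>The factor (n + 1)^2 from the two power sums turns the square of n! into that of
    (n + 1)!, while c^2 and zeta(2) are the contribution of the new prime.\<close>
  have C': "(\<Prod>q\<in>insert q S. 1 / (ln (real q))\<^sup>2) / ((fact (n + 1))\<^sup>2 * riemann_zeta 2 ^ (n + 1))
      = C / ((real (n + 1) * c)\<^sup>2 * riemann_zeta 2)"
    using insert by (simp add: C_def c_def power_mult_distrib mult_ac)
  show ?case
    unfolding card C'
  \<comment> \<open>The first summand collects the induction errors over at most (T / c)^2 exponent
    pairs, the second the error in summing the main terms.\<close>
  proof (intro exI[of _ "K / c\<^sup>2 + \<bar>C\<bar> * K'"] conjI allI impI)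
    show "0 \<le> K / c\<^sup>2 + \<bar>C\<bar> * K'" using K K' by simp
    fix T X Y :: real
    assume T: "2 \<le> T" and X: "0 \<le> X" "X \<le> T" and Y: "0 \<le> Y" "Y \<le> T"
    define A where "A = nat \<lfloor>X / c\<rfloor>"
    define B where "B = nat \<lfloor>Y / c\<rfloor>"
    \<comment> \<open>The shifted bounds stay between 0 and \<open>T\<close>, so the induction
      hypothesis controls every \<open>e a b\<close> with the same \<open>T\<close>.\<close>
    define e where "e a b = real (card (coprime_pairs S (X - real a * c) (Y - real b * c)))
        - C * ((X - real a * c) ^ n * (Y - real b * c) ^ n)" for a b
    define w where "w = (\<Sum>a\<in>{1..A}. \<Sum>b\<in>{1..B}.
        if coprime a b then (X - real a * c) ^ n * (Y - real b * c) ^ n else 0)"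
    define v where "v = X ^ (n + 1) * Y ^ (n + 1) / ((real (n + 1) * c)\<^sup>2 * riemann_zeta 2)"
    have split: "real (card (coprime_pairs (insert q S) X Y)) =
        (\<Sum>a\<in>{1..A}. \<Sum>b\<in>{1..B}. if coprime a b then e a b else 0) + C * w"
      unfolding card_coprime_pairs_insert[OF q insert(2) X(1) Y(1)] c_def[symmetric]
        A_def[symmetric] B_def[symmetric] w_def sum_distrib_left sum.distrib[symmetric] of_nat_sum
      by (intro sum.cong) (auto simp: e_def)
    have A: "real A * c \<le> X" and B: "real B * c \<le> Y"
      unfolding A_def B_def using nat_floor_divide_bounds(1)[OF c] X Y by auto
    have pos: "0 \<le> K * T ^ (2 * n) * ln T" using K T by simp
    have "T * \<bar>\<Sum>a\<in>{1..A}. \<Sum>b\<in>{1..B}. if coprime a b then e a b else 0\<bar>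
        \<le> T * (\<Sum>a\<in>{1..A}. \<Sum>b\<in>{1..B}. \<bar>if coprime a b then e a b else 0\<bar>)"
      using T by (intro mult_left_mono order.trans[OF sum_abs] sum_mono) auto
    also have "\<dots> = (\<Sum>a\<in>{1..A}. \<Sum>b\<in>{1..B}. T * \<bar>if coprime a b then e a b else 0\<bar>)"
      by (simp add: sum_distrib_left)
    also have "\<dots> \<le> (\<Sum>a\<in>{1..A}. \<Sum>b\<in>{1..B}. K * T ^ (2 * n) * ln T)"
    proof (intro sum_mono)
      fix a b assume ab: "a \<in> {1..A}" "b \<in> {1..B}"
      have "real a * c \<le> real A * c" "real b * c \<le> real B * c" "0 \<le> real a * c" "0 \<le> real b * c"
        using ab c by auto
      then have "T * \<bar>e a b\<bar> \<le> K * T ^ (2 * n) * ln T"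
        unfolding e_def using A B X Y T by (intro IH) auto
      then show "T * \<bar>if coprime a b then e a b else 0\<bar> \<le> K * T ^ (2 * n) * ln T"
        using pos by auto
    qed
    also have "\<dots> = real A * real B * (K * T ^ (2 * n) * ln T)" by simp
    also have "\<dots> \<le> (T / c) * (T / c) * (K * T ^ (2 * n) * ln T)"
      using A B X Y T c pos by (intro mult_right_mono mult_mono) (auto simp: pos_le_divide_eq)
    also have "\<dots> = K / c\<^sup>2 * T ^ (2 * (n + 1)) * ln T"
      by (simp add: power2_eq_square)
    finally have e1: "T * \<bar>\<Sum>a\<in>{1..A}. \<Sum>b\<in>{1..B}. if coprime a b then e a b else 0\<bar>
        \<le> K / c\<^sup>2 * T ^ (2 * (n + 1)) * ln T" .
    have "T * \<bar>C * w - C * v\<bar> = T * \<bar>C\<bar> * \<bar>w - v\<bar>"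
      by (simp add: right_diff_distrib[symmetric] abs_mult)
    also have "\<dots> \<le> T * \<bar>C\<bar> * (K' * T ^ (2 * n + 1) * ln T)"
      using W[OF T X Y] T unfolding w_def v_def A_def B_def by (intro mult_left_mono) auto
    also have "\<dots> = \<bar>C\<bar> * K' * T ^ (2 * (n + 1)) * ln T" by simp
    finally have e2: "T * \<bar>C * w - C * v\<bar> \<le> \<bar>C\<bar> * K' * T ^ (2 * (n + 1)) * ln T" .
    have "C / ((real (n + 1) * c)\<^sup>2 * riemann_zeta 2) * (X ^ (n + 1) * Y ^ (n + 1)) = C * v"
      by (simp add: v_def)
    then have "T * \<bar>real (card (coprime_pairs (insert q S) X Y)) -
        C / ((real (n + 1) * c)\<^sup>2 * riemann_zeta 2) * (X ^ (n + 1) * Y ^ (n + 1))\<bar>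
      = T * \<bar>(\<Sum>a\<in>{1..A}. \<Sum>b\<in>{1..B}. if coprime a b then e a b else 0) + (C * w - C * v)\<bar>"
      unfolding split by (simp only: add_diff_eq)
    also have "\<dots> \<le> T * \<bar>\<Sum>a\<in>{1..A}. \<Sum>b\<in>{1..B}. if coprime a b then e a b else 0\<bar> + T * \<bar>C * w - C * v\<bar>"
      unfolding distrib_left[symmetric] using T by (intro mult_left_mono abs_triangle_ineq) auto
    also have "\<dots> \<le> (K / c\<^sup>2 + \<bar>C\<bar> * K') * T ^ (2 * (n + 1)) * ln T"
      unfolding distrib_right using e1 e2 by linarith
    finally show "T * \<bar>real (card (coprime_pairs (insert q S) X Y)) -
        C / ((real (n + 1) * c)\<^sup>2 * riemann_zeta 2) * (X ^ (n + 1) * Y ^ (n + 1))\<bar>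
      \<le> (K / c\<^sup>2 + \<bar>C\<bar> * K') * T ^ (2 * (n + 1)) * ln T" .
  qed
qed

section \<open>Return to the original count\<close>

text \<open>A product of distinct primes determines the set of these primes, so fixing the kernel is
  fixing the prime factors. As \<open>r \<ge> 1\<close>, this set is nonempty, which excludes the
  value 1.\<close>

lemma exp_coprime_pairs_eq_coprime_pairs:
  assumes "r \<ge> 1" and pr: "\<And>i. i \<in> {1..r} \<Longrightarrow> prime (p i)" and inj: "inj_on p {1..r}" and "x > 0"
  shows "exp_coprime_pairs r p x = coprime_pairs (p ` {1..r}) (ln x) (ln x)"
proof -
  let ?S = "p ` {1..r}"
  have P: "(\<Prod>i\<in>{1..r}. p i) = \<Prod>?S" using inj by (simp add: prod.reindex)
  have pf: "prime_factors (\<Prod>A) = A" if "finite A" "\<And>q. q \<in> A \<Longrightarrow> prime q" for A :: "nat set"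
  proof -
    have "0 \<notin> A" using that(2) by fastforce
    then have "prime_factors (\<Prod>A) = (\<Union>q\<in>A. prime_factors q)"
      using prime_factors_prod[of A id] that by simp
    also have "\<dots> = A" using that by (auto simp: prime_prime_factors)
    finally show ?thesis .
  qed
  have ker: "squarefree_kernel n = (\<Prod>i\<in>{1..r}. p i) \<longleftrightarrow> prime_factors n = ?S" for n
  proof
    assume "squarefree_kernel n = (\<Prod>i\<in>{1..r}. p i)"
    then have "prime_factors (\<Prod>(prime_factors n)) = prime_factors (\<Prod>?S)"
      unfolding squarefree_kernel_def P by simp
    moreover have "prime_factors (\<Prod>(prime_factors n)) = prime_factors n" by (rule pf) auto
    moreover have "prime_factors (\<Prod>?S) = ?S" by (rule pf) (use pr in auto)
    ultimately show "prime_factors n = ?S" by simp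
  qed (simp only: squarefree_kernel_def P)
  have ne: "?S \<noteq> {}" using assms by simp
  have gt: "n > 1 \<longleftrightarrow> n > 0" if "prime_factors n = ?S" for n
  proof -
    have "n \<noteq> 1" using that ne by auto
    then show ?thesis by auto
  qed
  have le: "real n \<le> x \<longleftrightarrow> ln (real n) \<le> ln x" if "n > 0" for n
    using that \<open>x > 0\<close> by simp
  show ?thesis
    unfolding exp_coprime_pairs_def coprime_pairs_def exponentially_coprime_def ker
    using gt le by auto
qed

theorem theorem2:
  fixes r :: nat and p :: "nat \<Rightarrow> nat"
  assumes "r \<ge> 1"
    and "\<And>i. i \<in> {1..r} \<Longrightarrow> prime (p i)"
    and "inj_on p {1..r}"
  shows "(\<lambda>x::real. real (P_exp r p x)
            - 1 / ((fact r)\<^sup>2 * riemann_zeta 2 ^ r) * (\<Prod>i\<in>{1..r}. 1 / (ln (real (p i)))\<^sup>2)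
              * ln x ^ (2 * r))
         \<in> O[at_top](\<lambda>x. ln x ^ (2 * r - 1) * ln (ln x))"
proof -
  let ?S = "p ` {1..r}"
  have card: "card ?S = r" using assms by (simp add: card_image)
  have prod: "(\<Prod>q\<in>?S. 1 / (ln (real q))\<^sup>2) = (\<Prod>i\<in>{1..r}. 1 / (ln (real (p i)))\<^sup>2)"
    using assms by (simp add: prod.reindex)
  have "finite ?S" "\<And>q. q \<in> ?S \<Longrightarrow> prime q" using assms(2) by auto
  from coprime_pairs_asymp[OF this, unfolded card prod]
  obtain K where K: "\<forall>T X Y. 2 \<le> T \<longrightarrow> 0 \<le> X \<longrightarrow> X \<le> T \<longrightarrow> 0 \<le> Y \<longrightarrow> Y \<le> T \<longrightarrow>
    T * \<bar>real (card (coprime_pairs ?S X Y))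
      - (\<Prod>i\<in>{1..r}. 1 / (ln (real (p i)))\<^sup>2) / ((fact r)\<^sup>2 * riemann_zeta 2 ^ r) * (X ^ r * Y ^ r)\<bar>
    \<le> K * T ^ (2 * r) * ln T"
    by blast
  show ?thesis
  proof (rule bigoI[of _ K])
    show "\<forall>\<^sub>F x in at_top. norm (real (P_exp r p x)
            - 1 / ((fact r)\<^sup>2 * riemann_zeta 2 ^ r) * (\<Prod>i\<in>{1..r}. 1 / (ln (real (p i)))\<^sup>2)
              * ln x ^ (2 * r)) \<le> K * norm (ln x ^ (2 * r - 1) * ln (ln x))"
      \<comment> \<open>From exp 2 on, \<open>ln x \<ge> 2\<close>, so the uniform bound applies
        with \<open>T\<close>, \<open>X\<close> and \<open>Y\<close> all equal to
        \<open>ln x\<close>, and \<open>ln (ln x)\<close> is positive.\<close>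
      using eventually_ge_at_top[of "exp 2"]
    proof eventually_elim
      case (elim x)
      have x: "x > 0" using elim by (meson exp_gt_zero less_le_trans)
      define L where "L = ln x"
      have L: "L \<ge> 2" using elim x by (simp add: L_def ln_ge_iff)
      let ?d = "real (P_exp r p x)
            - 1 / ((fact r)\<^sup>2 * riemann_zeta 2 ^ r) * (\<Prod>i\<in>{1..r}. 1 / (ln (real (p i)))\<^sup>2) * L ^ (2 * r)"
      have P: "P_exp r p x = card (coprime_pairs ?S L L)"
        unfolding P_exp_def L_def using exp_coprime_pairs_eq_coprime_pairs[OF assms x] by simp
      have "L * \<bar>?d\<bar> \<le> K * L ^ (2 * r) * ln L"
        using K[rule_format, of L L L] L unfolding P by (simp add: power_add[symmetric] mult_2)
      \<comment> \<open>With \<open>r \<ge> 1\<close> the subtraction in \<open>2 * r - 1\<close> is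
        not truncated, so one factor \<open>L\<close> splits off and cancels.\<close>
      also have "\<dots> = K * (L * L ^ (2 * r - 1)) * ln L"
        using assms(1) by (simp add: power_eq_if)
      also have "\<dots> = L * (K * (L ^ (2 * r - 1) * ln L))" by (simp only: mult_ac)
      finally have "L * \<bar>?d\<bar> \<le> L * (K * (L ^ (2 * r - 1) * ln L))" .
      then have "\<bar>?d\<bar> \<le> K * (L ^ (2 * r - 1) * ln L)" using L by simp
      then show ?case using L unfolding L_def[symmetric] by simp
    qed
  qed
qed

end
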